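(* Let $r\ge 2$ be a fixed integer and assume that $\mathcal{A}_r\ne\emptyset$. Then for every nonzero rational number $q$ the diophantine equation $D_r(n)=q\cdot m!$ in unknown positive integers $n,m$ has only finitely many solutions. Moreover, for any prime $p\in\mathcal{A}_r$, every solution $(n,m)$ satisfies at least one of the following inequalities: $$m<(p-1)\left(1+\log_p m+r\log_p\bigl(r+er(2+q)\bigr)-v_p(q)\right),$$ $$m>p^{\frac{v_p(q)}{r+1}}\cdot p^{\frac{m}{(r+1)(p-1)}}.$$
   Context: For integers $n,r\ge 0$, the $r$-derangement number $D_r(n)$ is the number of permutations of $\{1,\dots,n+r\}$ that have no fixed points and in whose cycle decomposition the elements $1,\dots,r$ lie in pairwise distinct cycles; $D_r(n)=0$ if $n<r$. For $r\ge 1$ and $n\ge r$ define $$C_r(n)=\frac{(n-r)!}{n!}D_r(n)=\sum_{j=r}^{n}\binom{j}{r}(n-r)_{j-r}(-1)^{n-j},$$ where $(x)_m=x(x-1)\cdots(x-m+1)$ for $m\ge 1$ and $(x)_0=1$; thus $C_r(n)$ is an integer. $\mathcal{A}_r$ is the set of prime numbers $p$ such that $p\nmid C_r(n)$ for all $n\ge r$. $v_p$ denotes the $p$-adic valuation on $\mathbb{Q}$, $\log_p$ the logarithm to base $p$, and $e$ the base of the natural logarithm. (For $q<0$ there are no solutions since $D_r(n)\ge 0$, so the inequalities are asserted vacuously.) *)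

theory Defs
  imports
    Complex_Main
    "HOL-Computational_Algebra.Primes"
    "HOL-Combinatorics.Permutations"
    "HOL-Combinatorics.Orbits"
begin

(* For a permutation s of a finite set, orbit s x is the cycle of s through x
   (it contains x itself), so injectivity of orbit s on {1..r} says that 1, ..., r
   lie in pairwise distinct cycles. If n < r this set is empty: the images of 1, ..., r
   are then distinct elements of {r+1..n+r}. *)
definition r_derangements :: "nat \<Rightarrow> nat \<Rightarrow> (nat \<Rightarrow> nat) set" where
  "r_derangements r n =
     {s. s permutes {1..n + r} \<and> (\<forall>i\<in>{1..n + r}. s i \<noteq> i) \<and> inj_on (orbit s) {1..r}}"

definition r_derangement_number :: "nat \<Rightarrow> nat \<Rightarrow> nat" where
  "r_derangement_number r n = card (r_derangements r n)"

(* Only meant for r <= n. *)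
definition C_num :: "nat \<Rightarrow> nat \<Rightarrow> rat" where
  "C_num r n = fact (n - r) / fact n * of_nat (r_derangement_number r n)"

(* C_num r n is an integer given as a rational number, and divisibility by p is
   divisibility in the integers; the dvd relation on type rat would be trivial. *)
definition A_primes :: "nat \<Rightarrow> nat set" where
  "A_primes r =
     {p. prime p \<and> (\<forall>n\<ge>r. \<not> (\<exists>k::int. C_num r n = of_int (int p * k)))}"

(* Only meant for q \<noteq> 0: at q = 0 this gives 0 instead of infinity. *)
definition padic_val :: "nat \<Rightarrow> rat \<Rightarrow> int" where
  "padic_val p q =
     int (multiplicity (int p) (fst (quotient_of q)))
       - int (multiplicity (int p) (snd (quotient_of q)))"

end

(* Conjugation by permutations of {r+1..n+r} acts transitively on the possible images of
   1, ..., r, so D_r(n) is n(n-1)...(n-r+1) times an integer K. For p in A_r the prime p does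
   not divide K, hence p^v with v = v_p(D_r(n)) is at most (n-1) n^(r-1). On the other hand
   D_r(n) = q m! gives v = v_p(q) + v_p(m!), where v_p(m!) >= m/(p-1) - log_p (m+1).
   If n < r + er(2+q), these two bounds give the first inequality. Otherwise
   D_r(n) >= (n+1)!/(r+1) forces m >= n, and (m-1) m^(r-1) (m+1) < m^(r+1) gives the second.
   Each inequality bounds m, and m bounds n by the growth of D_r(n). *)
theory Submission
  imports Defs "HOL-Real_Asymp.Real_Asymp"
begin

section \<open>Valuations of factorials\<close>

text \<open>Raising \<open>j\<close> by one multiplies the left side by c + 1 and the right factor 1
  + j absorbs this: (1 + j) * (c + 1) <= (2 + j) * c as soon as 1 + j <= c. It supplies the growth
  ratio for \<open>power_swap_le\<close>.\<close>

lemma power_Suc_le_mult_power: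
  fixes c j :: nat
  assumes "j \<le> c"
  shows "(c + 1) ^ j \<le> (1 + j) * c ^ j"
  using assms
proof (induction j)
  case (Suc j)
  have "(c + 1) ^ Suc j \<le> (c + 1) * ((1 + j) * c ^ j)"
    using mult_left_mono[OF Suc.IH, of "c + 1"] Suc.prems by simp
  also have "\<dots> = c ^ j * ((1 + j) * c + (1 + j))"
    by (simp add: algebra_simps)
  also have "\<dots> \<le> c ^ j * ((1 + j) * c + c)"
    using Suc.prems by (intro mult_left_mono add_left_mono) auto
  finally show ?case by (simp add: algebra_simps)
qed simp

text \<open>A discrete form of the fact that log (1 + x) / x decreases. The two sides agree at k =
  d; from there each step multiplies the right side by 1 + d and the left side by at most that
  much.\<close>

lemma power_swap_le:
  fixes d k :: nat
  assumes "d \<le> k"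
  shows "(1 + k) ^ d \<le> (1 + d) ^ k"
  using assms
proof (induction k rule: dec_induct)
  case (step k)
  have "(1 + Suc k) ^ d \<le> (1 + d) * (1 + k) ^ d"
    using power_Suc_le_mult_power[of d "Suc k"] step.hyps by simp
  also have "\<dots> \<le> (1 + d) * (1 + d) ^ k"
    using step.IH by (intro mult_left_mono) auto
  finally show ?case by simp
qed simp

text \<open>The multiples of \<open>p\<close> up to \<open>n\<close> contribute p * 1, p * 2, ..., p
  * (n div p); the remaining factors are prime to \<open>p\<close> and are collected in
  \<open>K\<close>. This is one step of Legendre's formula.\<close>

lemma fact_eq_prime_power_mult_fact_div:
  fixes p n :: nat
  assumes "prime p"
  shows "\<exists>K. \<not> p dvd K \<and> fact n = p ^ (n div p) * fact (n div p) * K"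
proof (induction n)
  case 0
  show ?case using assms by (intro exI[of _ 1]) auto
next
  case (Suc n)
  then obtain K where K: "\<not> p dvd K" "fact n = p ^ (n div p) * fact (n div p) * K"
    by blast
  show ?case
  proof (cases "p dvd Suc n")
    case True
    then have d: "Suc n div p = Suc (n div p)"
      by (simp add: div_Suc dvd_eq_mod_eq_0)
    have "Suc n = p * Suc (n div p)"
      using True d by (metis dvd_mult_div_cancel)
    then have "fact (Suc n) = p * Suc (n div p) * (p ^ (n div p) * fact (n div p) * K)"
      using K(2) by (metis fact_Suc of_nat_id)
    then show ?thesis
      using K(1) unfolding d by (intro exI[of _ K]) (simp add: algebra_simps)
  next
    case False
    then have d: "Suc n div p = n div p"
      by (simp add: div_Suc dvd_eq_mod_eq_0)
    have "\<not> p dvd Suc n * K"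
      using K(1) False assms prime_dvd_mult_iff by blast
    moreover have "fact (Suc n) = p ^ (n div p) * fact (n div p) * (Suc n * K)"
      using K(2) by (simp add: algebra_simps)
    ultimately show ?thesis unfolding d by blast
  qed
qed

lemma multiplicity_fact_div:
  fixes p n :: nat
  assumes "prime p"
  shows "multiplicity p (fact n) = n div p + multiplicity p (fact (n div p))"
proof -
  obtain K where K: "\<not> p dvd K" "fact n = p ^ (n div p) * fact (n div p) * K"
    using fact_eq_prime_power_mult_fact_div[OF assms] by blast
  have "K \<noteq> 0" "p \<noteq> 0" using K(1) assms by (auto intro: Nat.gr0I)
  then show ?thesis
    using K(1) assms unfolding K(2)
    by (simp add: prime_elem_multiplicity_mult_distrib not_dvd_imp_multiplicity_0)
qed

text \<open>This is \<open>v\<^sub>p(m!) \<ge> m/(p - 1) - log\<^sub>p (m + 1)\<close>, cleared of logarithms and denominators.\<close>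

lemma prime_power_le_fact_multiplicity:
  fixes p m :: nat
  assumes "prime p"
  shows "p ^ m \<le> (p ^ multiplicity p (fact m) * (m + 1)) ^ (p - 1)"
proof (induction m rule: less_induct)
  case (less m)
  have p: "p \<ge> 2" using assms by (rule prime_ge_2_nat)
  show ?case
  proof (cases "m = 0")
    case False
    define k where "k = m div p"
    define d where "d = m mod p"
    define v where "v = multiplicity p (fact k)"
    have m: "m = p * k + d" by (simp add: k_def d_def)
    have d: "d < p" using p by (simp add: d_def)
    have "p = Suc (p - 1)" using p by simp
    then have "p * k + d = d + (p - 1) * k + k" by (metis add.commute add.left_commute mult_Suc)
    then have "p ^ m = p ^ d * p ^ ((p - 1) * k) * p ^ k" unfolding m by (simp add: power_add)
    \<comment> \<open>Here \<open>d\<close> is the last base-p digit of \<open>m\<close>. The factor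
      p^d is bounded by \<open>power_swap_le\<close> with exponent p - 1, the factor p^k by the
      induction hypothesis, and p^((p - 1) * k) is already a (p - 1)-th power.\<close>
    also have "\<dots> \<le> (1 + d) ^ (p - 1) * p ^ ((p - 1) * k) * (p ^ v * (k + 1)) ^ (p - 1)"
      using less[of k] power_swap_le[of d "p - 1"] False p d
      by (intro mult_mono) (auto simp: k_def v_def)
    also have "\<dots> = (p ^ (k + v) * ((1 + d) * (k + 1))) ^ (p - 1)"
      by (simp only: power_mult_distrib power_add power_mult mult.commute[of "p - 1"] mult_ac)
    also have "\<dots> \<le> (p ^ (k + v) * (m + 1)) ^ (p - 1)"
    proof -
      \<comment> \<open>The digit factors 1 + d multiply up to at most m + 1, because d <= p -
        1.\<close>
      have "d * k \<le> (p - 1) * k" using d by (intro mult_right_mono) auto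
      then have "(1 + d) * (k + 1) \<le> 1 + d + k + (p - 1) * k" by (simp add: algebra_simps)
      also have "\<dots> = m + 1" using \<open>p * k + d = _\<close> m by simp
      finally show ?thesis by (intro power_mono mult_left_mono) auto
    qed
    finally show ?thesis
      using multiplicity_fact_div[OF assms, of m] by (simp add: k_def v_def)
  qed simp
qed

lemma multiplicity_int_of_nat:
  fixes p n :: nat
  shows "multiplicity (int p) (int n) = multiplicity p n"
  by (simp add: multiplicity_def flip: of_nat_power)

text \<open>Cross-multiplication with the reduced fraction shows that the valuation can be read off
  from any representation of \<open>q\<close> as a quotient of positive integers, in particular from
  D_r(n) / m!.\<close>

lemma padic_val_eq:
  fixes p D F :: nat
  assumes "prime p" "D > 0" "F > 0" "of_nat D = q * of_nat F"
  shows "padic_val p q = int (multiplicity p D) - int (multiplicity p F)"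
proof -
  obtain a b where ab: "quotient_of q = (a, b)" by (cases "quotient_of q")
  have b: "b > 0" using quotient_of_denom_pos[OF ab] .
  have "q = of_int a / of_int b" using quotient_of_div[OF ab] .
  then have "of_int (int D * b) = (of_int (a * int F) :: rat)"
    using assms(4) b by (simp add: field_simps)
  then have eq: "int D * b = a * int F" by (simp only: of_int_eq_iff)
  have "a \<noteq> 0" using eq assms b by auto
  have pp: "prime_elem (int p)" using assms(1) by simp
  have "multiplicity (int p) (int D) + multiplicity (int p) b
      = multiplicity (int p) a + multiplicity (int p) (int F)"
    using arg_cong[OF eq, of "multiplicity (int p)"] assms(2,3) b \<open>a \<noteq> 0\<close>
    by (simp add: prime_elem_multiplicity_mult_distrib[OF pp])
  then show ?thesis
    by (simp add: padic_val_def ab multiplicity_int_of_nat)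
qed

section \<open>Counting r-derangements\<close>

text \<open>The complements of the two images in \<open>B\<close> have equal size, so any bijection
  between them completes the assignment f x -> g x. This is the transitivity of the symmetric group
  on tuples of distinct elements.\<close>

lemma permutes_extend_inj:
  fixes f g :: "'a \<Rightarrow> 'b"
  assumes "finite B" "inj_on f A" "inj_on g A" "f ` A \<subseteq> B" "g ` A \<subseteq> B"
  obtains h where "h permutes B" "\<And>x. x \<in> A \<Longrightarrow> h (f x) = g x"
proof -
  have fin: "finite A" using assms(1,2,4) by (meson finite_imageD finite_subset)
  have "card (B - f ` A) = card (B - g ` A)"
    using assms fin by (simp add: card_Diff_subset card_image)
  then obtain k where k: "bij_betw k (B - f ` A) (B - g ` A)"
    using assms(1) finite_same_card_bij by blast
  define h where "h y = (if y \<in> f ` A then g (inv_into A f y) else if y \<in> B then k y else y)" for y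
  have hf: "h (f x) = g x" if "x \<in> A" for x
    using that assms(2) by (simp add: h_def)
  have "bij_betw h (f ` A) (g ` A)"
    using assms(2,3) hf by (auto simp: bij_betw_def inj_on_def image_image)
  moreover have "bij_betw h (B - f ` A) (B - g ` A)"
    using k by (subst bij_betw_cong[of _ h k]) (auto simp: h_def)
  ultimately have "bij_betw h (f ` A \<union> (B - f ` A)) (g ` A \<union> (B - g ` A))"
    by (intro bij_betw_combine) auto
  then have "bij_betw h B B" using assms(4,5) by (simp add: Un_absorb1)
  moreover have "h y = y" if "y \<notin> B" for y using that assms(4) by (auto simp: h_def)
  ultimately have "h permutes B" by (rule bij_imp_permutes)
  then show ?thesis using hf that by blast
qed

section \<open>Conjugation, equal fibres and the divisibility of D_r(n)\<close>

lemma orbit_conj: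
  assumes "bij g"
  shows "orbit (g \<circ> s \<circ> inv g) (g x) = g ` orbit s x"
proof -
  have "((g \<circ> s \<circ> inv g) ^^ k) (g x) = g ((s ^^ k) x)" for k
    using assms by (induction k) (auto simp: bij_is_inj)
  then show ?thesis by (auto simp: orbit_altdef)
qed

text \<open>Cycles of a permutation that meet are equal. The pointwise form is the one suited to
  induction along \<open>orbit\<close>.\<close>

lemma inj_on_orbit_iff:
  assumes "permutation s"
  shows "inj_on (orbit s) A \<longleftrightarrow> (\<forall>i\<in>A. \<forall>j\<in>A. j \<in> orbit s i \<longrightarrow> i = j)"
proof -
  have "orbit s i = orbit s j \<longleftrightarrow> j \<in> orbit s i" for i j
    using permutation_self_in_orbit[OF assms] orbit_trans orbit_swap by (metis set_eqI)
  then show ?thesis by (auto simp: inj_on_def)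
qed

lemma r_derangements_iff:
  "s \<in> r_derangements r n \<longleftrightarrow>
     s permutes {1..n + r} \<and> (\<forall>i\<in>{1..n + r}. s i \<noteq> i) \<and>
     (\<forall>i\<in>{1..r}. \<forall>j\<in>{1..r}. j \<in> orbit s i \<longrightarrow> i = j)"
  unfolding r_derangements_def
  using inj_on_orbit_iff permutes_imp_permutation[of "{1..n + r}" s] by auto

lemma finite_r_derangements: "finite (r_derangements r n)"
  by (rule finite_subset[OF _ finite_permutations[of "{1..n + r}"]]) (auto simp: r_derangements_def)

text \<open>Conjugation by \<open>g\<close> relabels the cycles. Since \<open>g\<close> fixes 1,
  ..., r, the cycle of each such i goes to the cycle of the same i, so distinct cycles stay
  distinct.\<close>

lemma r_derangements_conj:
  assumes "s \<in> r_derangements r n" "g permutes {r+1..n + r}"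
  shows "g \<circ> s \<circ> inv g \<in> r_derangements r n"
proof -
  have g: "g permutes {1..n + r}" using assms(2) by (rule permutes_subset) auto
  have s: "s permutes {1..n + r}" "\<forall>i\<in>{1..n + r}. s i \<noteq> i" "inj_on (orbit s) {1..r}"
    using assms(1) by (auto simp: r_derangements_def)
  have "bij g" using g by (rule permutes_bij)
  have "orbit (g \<circ> s \<circ> inv g) i = g ` orbit s i" if "i \<in> {1..r}" for i
  proof -
    have "g i = i" using that permutes_not_in[OF assms(2)] by auto
    then show ?thesis using orbit_conj[OF \<open>bij g\<close>, of s i] by simp
  qed
  then have "inj_on (orbit (g \<circ> s \<circ> inv g)) {1..r} \<longleftrightarrow> inj_on ((`) g \<circ> orbit s) {1..r}"
    by (intro inj_on_cong) simp
  then have "inj_on (orbit (g \<circ> s \<circ> inv g)) {1..r}"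
    using comp_inj_on[OF s(3), of "(`) g"] permutes_inj[OF g]
    by (meson inj_image_eq_iff inj_onI)
  moreover have "(g \<circ> s \<circ> inv g) i \<noteq> i" if "i \<in> {1..n + r}" for i
  proof -
    have "inv g i \<in> {1..n + r}" using that permutes_in_image[OF permutes_inv[OF g]] by blast
    then have "s (inv g i) \<noteq> inv g i" using s(2) by blast
    then show ?thesis using permutes_inverses(2)[OF g] by (metis comp_apply)
  qed
  ultimately show ?thesis
    using permutes_compose[OF permutes_compose[OF permutes_inv[OF g] s(1)] g]
    by (simp add: r_derangements_def comp_assoc)
qed

text \<open>The image s i lies in the cycle of i and differs from i; a value in {1..r} would put two
  of the elements 1, ..., r into one cycle.\<close>

lemma r_derangements_heads:
  assumes "s \<in> r_derangements r n"
  shows "distinct (map s [1..<r+1])" "set (map s [1..<r+1]) \<subseteq> {r+1..n+r}"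
proof -
  have s: "s permutes {1..n + r}" "\<forall>i\<in>{1..n + r}. s i \<noteq> i"
      "\<forall>i\<in>{1..r}. \<forall>j\<in>{1..r}. j \<in> orbit s i \<longrightarrow> i = j"
    using assms unfolding r_derangements_iff by blast+
  show "distinct (map s [1..<r+1])"
    using permutes_inj_on[OF s(1)] by (simp add: distinct_map)
  have "s i \<in> {r+1..n+r}" if i: "i \<in> {1..r}" for i
  proof -
    have "s i \<in> {1..n+r}" using i permutes_in_image[OF s(1), of i] by auto
    moreover have "s i \<noteq> i" using s(2) i by auto
    then have "s i \<notin> {1..r}" using s(3) i orbit.base[of s i] by metis
    ultimately show ?thesis by auto
  qed
  then show "set (map s [1..<r+1]) \<subseteq> {r+1..n+r}" by auto
qed

lemma r_derangement_number_eq_0: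
  assumes "n < r"
  shows "r_derangement_number r n = 0"
proof -
  have False if "s \<in> r_derangements r n" for s
    using card_mono[OF _ r_derangements_heads(2)[OF that]] distinct_card[OF r_derangements_heads(1)[OF that]] assms
    by simp
  then have "r_derangements r n = {}" by auto
  then show ?thesis by (simp add: r_derangement_number_def)
qed

text \<open>Some \<open>g\<close> carries \<open>xs\<close> to \<open>ys\<close> and fixes 1, ...,
  r, so conjugation by it embeds one fibre into the other. The hypotheses are symmetric in
  \<open>xs\<close> and \<open>ys\<close>, so equality follows by exchanging them.\<close>

lemma r_derangements_fibre_le:
  assumes "distinct xs" "distinct ys" "length xs = r" "length ys = r"
    "set xs \<subseteq> {r+1..n+r}" "set ys \<subseteq> {r+1..n+r}"
  shows "card {s \<in> r_derangements r n. map s [1..<r+1] = xs}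
       \<le> card {s \<in> r_derangements r n. map s [1..<r+1] = ys}"
proof -
  have "(!) xs ` {..<r} = set xs" "(!) ys ` {..<r} = set ys"
    using assms(3,4) by (auto simp: set_conv_nth)
  moreover have "inj_on ((!) xs) {..<r}" "inj_on ((!) ys) {..<r}"
    using assms by (auto intro: inj_on_nth)
  ultimately obtain g where g: "g permutes {r+1..n+r}" "\<And>i. i \<in> {..<r} \<Longrightarrow> g (xs ! i) = ys ! i"
    using permutes_extend_inj[of "{r+1..n+r}" "(!) xs" "{..<r}" "(!) ys"] assms(5,6)
    by (metis finite_atLeastAtMost)
  have "map g xs = ys" using g(2) assms(3,4) by (intro nth_equalityI) auto
  have invg: "inv g i = i" if "i \<in> {1..r}" for i
    using that permutes_not_in[OF permutes_inv[OF g(1)], of i] by auto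
  have "inj_on (\<lambda>s. g \<circ> s \<circ> inv g) X" for X
    using permutes_inv_o[OF g(1)]
    by (intro inj_on_inverseI[where g = "\<lambda>s. inv g \<circ> s \<circ> g"]) (metis comp_assoc comp_id id_comp)
  moreover have "(\<lambda>s. g \<circ> s \<circ> inv g) ` {s \<in> r_derangements r n. map s [1..<r+1] = xs}
      \<subseteq> {s \<in> r_derangements r n. map s [1..<r+1] = ys}"
  proof safe
    fix s assume s: "s \<in> r_derangements r n" "xs = map s [1..<r+1]"
    show "g \<circ> s \<circ> inv g \<in> r_derangements r n" using s(1) g(1) by (rule r_derangements_conj)
    have "map (g \<circ> s \<circ> inv g) [1..<r+1] = map g (map s [1..<r+1])"
      using invg by auto
    then show "map (g \<circ> s \<circ> inv g) [1..<r+1] = ys"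
      unfolding s(2)[symmetric] \<open>map g xs = ys\<close> .
  qed
  ultimately show ?thesis
    by (intro card_inj_on_le) (auto intro: finite_subset[OF _ finite_r_derangements])
qed

text \<open>The image lists of 1, ..., r range over \<open>L\<close>, which has n (n - 1) ... (n - r
  + 1) elements, and all fibres have the same size \<open>K\<close>. So \<open>K\<close> is C_r(n),
  written without division.\<close>

lemma fact_dvd_r_derangement_number:
  assumes "r \<le> n"
  obtains K where "fact (n - r) * r_derangement_number r n = fact n * K"
proof -
  define L where "L = {xs. length xs = r \<and> distinct xs \<and> set xs \<subseteq> {r+1..n+r}}"
  define F where "F xs = {s \<in> r_derangements r n. map s [1..<r+1] = xs}" for xs
  have cardL: "card L = \<Prod>{n - r + 1..n}"
    unfolding L_def using assms by (subst card_lists_distinct_length_eq) auto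
  have "finite L" unfolding L_def by (rule finite_subset[OF _ finite_lists_length_eq[of "{r+1..n+r}" r]]) auto
  obtain K where K: "\<And>xs. xs \<in> L \<Longrightarrow> card (F xs) = K"
  proof (cases "L = {}")
    case False
    then obtain ys where "ys \<in> L" by auto
    then have "card (F xs) = card (F ys)" if "xs \<in> L" for xs
      using that unfolding F_def L_def by (intro antisym r_derangements_fibre_le) auto
    then show ?thesis using that by blast
  qed (use that in auto)
  have "r_derangements r n = (\<Union>xs\<in>L. F xs)"
    using r_derangements_heads unfolding L_def F_def by fastforce
  also have "card \<dots> = (\<Sum>xs\<in>L. card (F xs))"
    using \<open>finite L\<close> by (intro card_UN_disjoint) (auto simp: F_def finite_r_derangements)
  also have "\<dots> = card L * K" using K by simp
  finally have "r_derangement_number r n = \<Prod>{n - r + 1..n} * K"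
    by (simp add: r_derangement_number_def cardL)
  moreover have "fact n = fact (n - r) * \<Prod>{n - r + 1..n}"
    using fact_eq_fact_times[of "n - r" n] by simp
  ultimately show ?thesis using that[of K] by (simp add: mult_ac)
qed

section \<open>Growth of D_r(n) by inserting a new point into a cycle\<close>

text \<open>For \<open>z\<close> fixed by \<open>s\<close>, composing with the transposition inserts \<open>z\<close> right after \<open>x\<close>
  in the cycle of \<open>x\<close>.\<close>

lemma orbit_comp_transpose_subset:
  assumes "permutation s" "s z = z" "i \<noteq> z" "y \<in> orbit (s \<circ> transpose x z) i"
  shows "if y = z then x \<in> orbit s i else y \<in> orbit s i"
  \<comment> \<open>The new cycle reaches \<open>z\<close> only from \<open>x\<close> and leaves it
    to s x, so a visit to \<open>z\<close> is recorded as a visit to \<open>x\<close>. Injectivity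
    of \<open>s\<close> with s z = z rules out any other way into \<open>z\<close>.\<close>
  using assms(4)
proof induction
  case base
  show ?case
    using assms(2,3) permutation_self_in_orbit[OF assms(1)] orbit.base[of s i]
    by (auto simp: transpose_def)
      (metis assms(1) bij_is_inj inj_eq permutation_bijective)
next
  case (step y)
  show ?case
    using step.IH assms(2) orbit.step[of _ s i]
    by (auto simp: transpose_def split: if_splits)
      (metis assms(1) bij_is_inj inj_eq permutation_bijective)+
qed

text \<open>A point inserted into an existing cycle creates no fixed point and merges no
  cycles.\<close>

lemma r_derangements_insert:
  assumes "s \<in> r_derangements r n" "x \<in> {1..n + r}"
  shows "s \<circ> transpose x (Suc (n + r)) \<in> r_derangements r (Suc n)"
proof -
  let ?z = "Suc (n + r)"
  have s: "s permutes {1..n + r}" "\<forall>i\<in>{1..n + r}. s i \<noteq> i"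
      "\<forall>i\<in>{1..r}. \<forall>j\<in>{1..r}. j \<in> orbit s i \<longrightarrow> i = j"
    using assms unfolding r_derangements_iff by blast+
  have sz: "s ?z = ?z" using permutes_not_in[OF s(1)] by auto
  have "s permutes {1..Suc n + r}" using s(1) by (rule permutes_subset) auto
  moreover have "transpose x ?z permutes {1..Suc n + r}"
    using assms(2) by (intro permutes_swap_id) auto
  ultimately have "s \<circ> transpose x ?z permutes {1..Suc n + r}"
    using permutes_compose by blast
  moreover have "(s \<circ> transpose x ?z) i \<noteq> i" if "i \<in> {1..Suc n + r}" for i
  proof -
    have "s x \<noteq> ?z" using permutes_in_image[OF s(1), of x] assms(2) by auto
    then show ?thesis using that s(2) sz assms(2) by (cases "i = ?z") (auto simp: transpose_def)
  qed
  moreover have "i = j" if "i \<in> {1..r}" "j \<in> {1..r}" "j \<in> orbit (s \<circ> transpose x ?z) i" for i j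
  proof -
    have "i \<noteq> ?z" "j \<noteq> ?z" using that(1,2) by auto
    then have "j \<in> orbit s i"
      using orbit_comp_transpose_subset[OF permutes_imp_permutation[OF _ s(1)] sz _ that(3)] by simp
    then show ?thesis using that(1,2) s(3) by blast
  qed
  ultimately show ?thesis unfolding r_derangements_iff by blast
qed

text \<open>There are n + r places for the new point, and different choices give different
  permutations. Only an inequality results, since permutations with the new point in a 2-cycle are
  not reached.\<close>

lemma r_derangement_number_Suc_ge:
  "(n + r) * r_derangement_number r n \<le> r_derangement_number r (Suc n)"
proof -
  let ?z = "Suc (n + r)"
  let ?f = "\<lambda>(x, s). s \<circ> transpose x ?z"
  have "inj_on ?f ({1..n + r} \<times> r_derangements r n)"
  proof (rule inj_onI, clarify)
    fix x y s t
    assume h: "x \<in> {1..n + r}" "y \<in> {1..n + r}" "s \<in> r_derangements r n" "t \<in> r_derangements r n"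
      and eq: "s \<circ> transpose x ?z = t \<circ> transpose y ?z"
    have s: "s permutes {1..n + r}" and t: "t permutes {1..n + r}"
      using h by (auto simp: r_derangements_def)
    have "s ?z = ?z" "t ?z = ?z" using permutes_not_in[OF s] permutes_not_in[OF t] by auto
    \<comment> \<open>The inserted-after point is recovered as the preimage of the new
      point.\<close>
    then have "(s \<circ> transpose x ?z) x = ?z" "(t \<circ> transpose y ?z) y = ?z"
      by simp_all
    then have "(t \<circ> transpose y ?z) x = ?z" "(t \<circ> transpose y ?z) y = ?z"
      unfolding eq .
    then have "x = y"
      using injD[OF inj_compose[OF permutes_inj[OF t] inj_on_transpose[of y ?z UNIV]]] by metis
    then have "s = t" using eq by (metis comp_assoc comp_id transpose_comp_involutory)
    then show "x = y \<and> s = t" using \<open>x = y\<close> by simp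
  qed
  moreover have "?f ` ({1..n + r} \<times> r_derangements r n) \<subseteq> r_derangements r (Suc n)"
    using r_derangements_insert by auto
  ultimately have "card ({1..n + r} \<times> r_derangements r n) \<le> card (r_derangements r (Suc n))"
    using finite_r_derangements by (intro card_inj_on_le) auto
  then show ?thesis by (simp add: r_derangement_number_def card_cartesian_product)
qed

lemma r_derangement_number_self_pos: "r_derangement_number r r > 0"
proof -
  \<comment> \<open>The witness is the involution that swaps i with i + r for i in 1, ...,
    r.\<close>
  define s where "s i = (if i \<in> {1..r} then i + r else if i \<in> {r+1..r+r} then i - r else i)" for i
  have ss: "s (s i) = i" for i by (auto simp: s_def)
  have "s permutes {1..r + r}"
    by (rule bij_imp_permutes, rule bij_betw_byWitness[where f' = s])
      (auto simp: ss, auto simp: s_def split: if_splits)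
  moreover have "s i \<noteq> i" if "i \<in> {1..r + r}" for i using that by (auto simp: s_def)
  moreover have "i = j" if "i \<in> {1..r}" "j \<in> {1..r}" "j \<in> orbit s i" for i j
  proof -
    have "j \<in> {i, i + r}" using that(3)
    proof induction
      case base show ?case using that(1) by (auto simp: s_def)
    next
      case (step y) then show ?case using that(1) by (auto simp: s_def)
    qed
    then show ?thesis using that by auto
  qed
  ultimately have "s \<in> r_derangements r r" unfolding r_derangements_iff by blast
  then show ?thesis using finite_r_derangements by (auto simp: r_derangement_number_def card_gt_0_iff)
qed

lemma fact_le_r_derangement_number:
  assumes "r \<ge> 2" "n \<ge> r"
  shows "fact (n + 1) \<le> (r + 1) * r_derangement_number r n"
  using assms(2)
proof (induction n rule: dec_induct)
  \<comment> \<open>D_r(r) is a positive multiple of r!, and (r + 1) * r! = (r + 1)!; this is where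
    the factor r + 1 comes from.\<close>
  case base
  obtain K where "fact (r - r) * r_derangement_number r r = fact r * K"
    using fact_dvd_r_derangement_number[of r r] by blast
  then have "fact r \<le> r_derangement_number r r"
    using r_derangement_number_self_pos[of r] by (cases K) auto
  then show ?case using mult_left_mono[of _ _ "r + 1"] by simp
next
  case (step n)
  have "fact (Suc n + 1) = (n + 2) * fact (n + 1)" by simp
  \<comment> \<open>The growth factor n + r is at least n + 2 because r >= 2.\<close>
  also have "\<dots> \<le> (n + r) * ((r + 1) * r_derangement_number r n)"
    using step.IH assms(1) by (intro mult_mono) auto
  also have "\<dots> = (r + 1) * ((n + r) * r_derangement_number r n)" by (simp only: mult_ac)
  also have "\<dots> \<le> (r + 1) * r_derangement_number r (Suc n)"
    using r_derangement_number_Suc_ge by (intro mult_left_mono) auto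
  finally show ?case .
qed

section \<open>The equation with factorials\<close>

lemma C_num_eq_of_nat:
  fixes n r K :: nat
  assumes "fact (n - r) * r_derangement_number r n = fact n * K"
  shows "C_num r n = of_nat K"
proof -
  have "of_nat (fact (n - r) * r_derangement_number r n) = (of_nat (fact n * K) :: rat)"
    using assms by (simp only:)
  then have "fact (n - r) * of_nat (r_derangement_number r n) = (fact n * of_nat K :: rat)"
    by simp
  then show ?thesis
    by (simp add: C_num_def field_simps)
qed

text \<open>Each factor of the falling factorial is bounded by \<open>n\<close>, except that n - 1
  is kept. This saving later makes (m - 1) * m^(r - 1) * (m + 1) strictly smaller than m^(r +
  1).\<close>

lemma fact_le_fact_diff_mult_power:
  fixes n r :: nat
  assumes "2 \<le> r" "r \<le> n"
  shows "fact n \<le> fact (n - r) * ((n - 1) * n ^ (r - 1))"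
  using assms
proof (induction r rule: dec_induct)
  case base
  then obtain k where "n = Suc (Suc k)"
    by (metis One_nat_def Suc_le_D Suc_1 Suc_le_mono)
  then show ?case by (simp add: algebra_simps)
next
  case (step r)
  have "fact (n - r) = (n - r) * fact (n - Suc r)"
    using step.prems fact_reduce[of "n - r", where 'a = nat] by simp
  also have "\<dots> \<le> n * fact (n - Suc r)" by (intro mult_right_mono) auto
  finally have "fact (n - r) * ((n - 1) * n ^ (r - 1)) \<le> n * fact (n - Suc r) * ((n - 1) * n ^ (r - 1))"
    by (intro mult_right_mono) auto
  also have "n ^ r = n * n ^ (r - 1)"
    using step.hyps by (cases r) auto
  then have "n * fact (n - Suc r) * ((n - 1) * n ^ (r - 1)) = fact (n - Suc r) * ((n - 1) * n ^ (Suc r - 1))"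
    by simp
  finally show ?case using step by linarith
qed

text \<open>In D_r(n) = P * K with P = n! / (n - r)!, the cofactor \<open>K\<close> is C_r(n) and
  prime to \<open>p\<close>, so the whole p-part divides the positive number
  \<open>P\<close>.\<close>

lemma power_multiplicity_r_derangement_number_le:
  fixes p n r :: nat
  assumes "p \<in> A_primes r" "2 \<le> r" "r \<le> n"
  shows "p ^ multiplicity p (r_derangement_number r n) \<le> (n - 1) * n ^ (r - 1)"
proof -
  let ?v = "multiplicity p (r_derangement_number r n)"
  have p: "prime p" using assms(1) by (simp add: A_primes_def)
  obtain K where K: "fact (n - r) * r_derangement_number r n = fact n * K"
    using fact_dvd_r_derangement_number[OF assms(3)] by blast
  have "\<not> p dvd K"
  proof
    assume "p dvd K"
    then obtain k where "K = p * k" by auto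
    then have "C_num r n = of_int (int p * int k)"
      using C_num_eq_of_nat[OF K] by simp
    then show False using assms(1,3) unfolding A_primes_def by blast
  qed
  have "fact (n - r) dvd (fact n :: nat)" by (intro fact_dvd) simp
  then obtain P where P: "fact n = fact (n - r) * (P :: nat)" by auto
  then have "r_derangement_number r n = P * K" using K by (simp add: mult.assoc)
  moreover have "p ^ ?v dvd r_derangement_number r n" by (rule multiplicity_dvd)
  moreover have "coprime (p ^ ?v) K"
    using p \<open>\<not> p dvd K\<close> by (simp add: prime_imp_coprime)
  ultimately have "p ^ ?v dvd P" by (simp add: coprime_dvd_mult_left_iff)
  moreover have "P > 0" using P by (metis fact_nonzero gr0I mult_0_right)
  ultimately have "p ^ ?v \<le> P" by (rule dvd_imp_le)
  also have "P \<le> (n - 1) * n ^ (r - 1)"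
    using fact_le_fact_diff_mult_power[OF assms(2,3)] unfolding P by simp
  finally show ?thesis .
qed

text \<open>This is \<open>prime_power_le_fact_multiplicity\<close> after taking logarithms, with
  v_p(m!) = v_p(D) - v_p(q). The right side stays the logarithm of a natural number, so that integer
  bounds on it can be substituted.\<close>

lemma padic_val_add_le_log:
  fixes p D m :: nat
  assumes "prime p" "D > 0" "of_nat D = q * fact m"
  shows "real_of_int (padic_val p q) + real m / (real p - 1)
    \<le> log (real p) (real (p ^ multiplicity p D * (m + 1)))"
proof -
  define w where "w = multiplicity p (fact m :: nat)"
  have p: "p \<ge> 2" using assms(1) by (rule prime_ge_2_nat)
  have "p ^ m \<le> (p ^ w * (m + 1)) ^ (p - 1)"
    unfolding w_def by (rule prime_power_le_fact_multiplicity[OF assms(1)])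
  then have "real (p ^ m) \<le> real ((p ^ w * (m + 1)) ^ (p - 1))"
    by (rule of_nat_mono)
  then have "real p ^ m \<le> (real p ^ w * (real m + 1)) ^ (p - 1)"
    unfolding of_nat_mult of_nat_power of_nat_add of_nat_1 .
  then have "log (real p) (real p ^ m) \<le> log (real p) ((real p ^ w * (real m + 1)) ^ (p - 1))"
    by (rule log_mono[rotated 2]) (use p in auto)
  also have "\<dots> = real (p - 1) * log (real p) (real p ^ w * (real m + 1))"
    using p by (subst log_nat_power) auto
  also have "log (real p) (real p ^ w * (real m + 1)) = real w + log (real p) (real m + 1)"
    using p by (subst log_mult) auto
  also have "log (real p) (real p ^ m) = real m" using p by simp
  finally have "real m \<le> (real p - 1) * (real w + log (real p) (real m + 1))"
    using p by (simp add: of_nat_diff)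
  then have "real m / (real p - 1) \<le> real w + log (real p) (real m + 1)"
    using p by (simp add: field_simps)
  moreover have "padic_val p q = int (multiplicity p D) - int w"
    unfolding w_def using assms by (intro padic_val_eq) auto
  moreover have "log (real p) (real (p ^ multiplicity p D * (m + 1)))
      = real (multiplicity p D) + log (real p) (real m + 1)"
    using p unfolding of_nat_mult of_nat_power
    by (subst log_mult) (auto simp: log_nat_power add.commute)
  ultimately show ?thesis by simp
qed

section \<open>The two inequalities for solutions\<close>

lemma r_derangement_solution_pos:
  assumes "of_nat (r_derangement_number r n) = q * fact m" "q \<noteq> (0::rat)"
  shows "r_derangement_number r n > 0" "q > 0" "r \<le> n"
proof -
  have "of_nat (r_derangement_number r n) \<noteq> (0::rat)" using assms by simp
  then show "r_derangement_number r n > 0" by simp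
  then have "q * fact m > 0" unfolding assms(1)[symmetric] by simp
  then show "q > 0" by (simp add: zero_less_mult_iff)
  show "r \<le> n" using \<open>r_derangement_number r n > 0\<close> r_derangement_number_eq_0[of n r] by linarith
qed

lemma r_derangement_solution_bounds:
  fixes n m p r :: nat and q :: rat
  assumes "2 \<le> r" "p \<in> A_primes r" "q \<noteq> 0" "m > 0"
    and sol: "of_nat (r_derangement_number r n) = q * fact m"
  shows "real m < (real p - 1) *
             (1 + log (real p) (real m)
                + real r * log (real p) (real r + exp 1 * real r * (2 + real_of_rat q))
                - real_of_int (padic_val p q))
        \<or> real m > real p powr (real_of_int (padic_val p q) / (real r + 1))
                    * real p powr (real m / ((real r + 1) * (real p - 1)))"
proof -
  define D where "D = r_derangement_number r n"
  define v where "v = multiplicity p D"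
  define X where "X = real r + exp 1 * real r * (2 + real_of_rat q)"
  define P where "P = real_of_int (padic_val p q)"
  have pr: "prime p" using assms(2) by (simp add: A_primes_def)
  then have p: "real p \<ge> 2" using prime_ge_2_nat by force
  note pos = r_derangement_solution_pos[OF sol assms(3)]
  have qp: "real_of_rat q > 0" using pos(2) by simp
  have val: "P + real m / (real p - 1) \<le> log (real p) (real (p ^ v * (m + 1)))"
    unfolding P_def v_def using pr pos(1) sol D_def by (intro padic_val_add_le_log) auto
  have pv: "p ^ v \<le> (n - 1) * n ^ (r - 1)"
    unfolding v_def D_def using power_multiplicity_r_derangement_number_le assms(1,2) pos(3) by blast
  have "0 < p ^ v * (m + 1)" using p by (intro mult_pos_pos) auto
  then have vpos: "0 < real (p ^ v * (m + 1))" by (rule of_nat_0_less_iff[THEN iffD2])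
  have nr: "n \<ge> 2" using assms(1) pos(3) by simp
  show ?thesis
  \<comment> \<open>The threshold \<open>X\<close> is the argument of the second logarithm in the
    first inequality.\<close>
  proof (cases "real n < X")
    case True
    have "(n - 1) * n ^ (r - 1) \<le> n * n ^ (r - 1)" by simp
    also have "\<dots> = n ^ r" using assms(1) by (cases r) auto
    finally have "p ^ v \<le> n ^ r" using pv by linarith
    \<comment> \<open>Replacing m + 1 by p * m produces the summand 1 + log_p m.\<close>
    moreover have "m + 1 \<le> p * m"
    proof -
      have "2 * m \<le> p * m" using p by (intro mult_right_mono) auto
      then show ?thesis using assms(4) by linarith
    qed
    ultimately have "p ^ v * (m + 1) \<le> n ^ r * (p * m)" by (intro mult_mono) auto
    then have "real (p ^ v * (m + 1)) \<le> real n ^ r * (real p * real m)"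
      by (metis of_nat_le_iff of_nat_mult of_nat_power)
    then have "log (real p) (real (p ^ v * (m + 1))) \<le> log (real p) (real n ^ r * (real p * real m))"
      using p vpos by (intro log_mono) auto
    also have "\<dots> = real r * log (real p) (real n) + (1 + log (real p) (real m))"
      using p nr assms(4) by (simp add: log_mult log_nat_power)
    also have "\<dots> < real r * log (real p) X + (1 + log (real p) (real m))"
      using True nr p assms(1) by simp
    finally have "real m / (real p - 1) < 1 + log (real p) (real m) + real r * log (real p) X - P"
      using val by linarith
    then have "real m < (real p - 1) * (1 + log (real p) (real m) + real r * log (real p) X - P)"
      using p by (simp add: field_simps)
    then show ?thesis unfolding X_def P_def by blast
  next
    case False
    have e: "exp 1 \<ge> (2::real)" using exp_ge_add_one_self[of "1::real"] by simp
    \<comment> \<open>\<open>X\<close> dominates (r + 1) * q, since r + 1 <= 2 * r and 2 <=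
      e.\<close>
    have "(real r + 1) * real_of_rat q \<le> real r * (2 * real_of_rat q)"
      using assms(1) qp by (simp add: algebra_simps)
    also have "\<dots> \<le> real r * (exp 1 * real_of_rat q)"
      using e qp by (intro mult_left_mono mult_right_mono) auto
    also have "\<dots> \<le> X"
      using qp unfolding X_def by (simp add: algebra_simps)
    finally have q: "(real r + 1) * real_of_rat q \<le> real n" using False by simp
    have "real (fact (n + 1)) \<le> real ((r + 1) * D)"
      unfolding D_def using fact_le_r_derangement_number[OF assms(1) pos(3)] of_nat_mono by blast
    moreover have "real D = real_of_rat q * fact m"
    proof -
      have "real_of_rat (fact m) = fact m" by (metis of_nat_fact of_rat_of_nat_eq)
      then show ?thesis
        using arg_cong[OF sol, of real_of_rat] unfolding D_def of_rat_mult by simp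
    qed
    \<comment> \<open>The lower bound on D_r(n) gives (n + 1)! <= (r + 1) * q * m! <= n * m!, hence
      n! < m!.\<close>
    ultimately have "(real n + 1) * fact n \<le> ((real r + 1) * real_of_rat q) * fact m"
      by (simp add: algebra_simps)
    also have "\<dots> \<le> real n * fact m" using q by (intro mult_right_mono) auto
    finally have "(real n + 1) * fact n \<le> real n * fact m" .
    moreover have "real n * fact n < (real n + 1) * fact n" by simp
    ultimately have "real n * fact n < real n * fact m" by linarith
    then have "fact n < (fact m :: real)" using nr by simp
    then have nm: "n \<le> m" using fact_mono[of m n, where 'a = real] by linarith
    have "p ^ v * (m + 1) \<le> (m - 1) * m ^ (r - 1) * (m + 1)"
      using pv nm by (intro mult_right_mono order.trans[OF pv] mult_mono power_mono diff_le_mono) auto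
    also have "\<dots> < m ^ (r + 1)"
    proof -
      obtain k where k: "m = Suc k" using assms(4) by (cases m) auto
      obtain t where t: "r = Suc t" using assms(1) by (cases r) auto
      \<comment> \<open>With m = k + 1 this is (m - 1) * (m + 1) < m^2.\<close>
      have "k * (k + 2) < (k + 1) * (k + 1)" by (simp add: algebra_simps)
      then have "(k + 1) ^ t * (k * (k + 2)) < (k + 1) ^ t * ((k + 1) * (k + 1))" by simp
      then show ?thesis unfolding k t by (simp add: algebra_simps)
    qed
    finally have "real (p ^ v * (m + 1)) < real m ^ (r + 1)"
      by (metis of_nat_less_iff of_nat_power)
    then have "log (real p) (real (p ^ v * (m + 1))) < log (real p) (real m ^ (r + 1))"
      using p vpos by (intro log_less) auto
    also have "\<dots> = (real r + 1) * log (real p) (real m)"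
      using assms(4) by (subst log_nat_power) auto
    finally have "P + real m / (real p - 1) < (real r + 1) * log (real p) (real m)"
      using val by linarith
    then have "(P + real m / (real p - 1)) / (real r + 1) < log (real p) (real m)"
      by (simp add: field_simps)
    moreover have "(P + real m / (real p - 1)) / (real r + 1)
        = P / (real r + 1) + real m / ((real r + 1) * (real p - 1))"
      by (simp add: add_divide_distrib mult.commute)
    ultimately have "real p powr (P / (real r + 1) + real m / ((real r + 1) * (real p - 1)))
        < real p powr log (real p) (real m)"
      using p by (intro powr_less_mono) auto
    then have "real p powr (P / (real r + 1)) * real p powr (real m / ((real r + 1) * (real p - 1))) < real m"
      using p assms(4) by (simp add: powr_add)
    then show ?thesis unfolding P_def by blast
  qed
qed

section \<open>Finiteness of the solution set\<close>

text \<open>Both inequalities fail for large \<open>m\<close>: a logarithm cannot keep up with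
  \<open>m\<close>, and \<open>m\<close> cannot keep up with an exponential. The separate constants
  mirror the shape of the two bounds.\<close>

lemma eventually_not_log_or_exp_bound:
  fixes a b c d k x y :: real
  assumes "b > 1" "c > 0" "k > 0"
  shows "eventually (\<lambda>m::nat. \<not> (real m < d * (a + log b (real m) + x - y)
           \<or> real m > c * b powr (real m / k))) sequentially"
proof -
  have lb: "ln b > 0" using assms by simp
  have "(\<lambda>m. ln (real m) / real m) \<longlonglongrightarrow> 0" by real_asymp
  then have "(\<lambda>m. ln (real m) / real m / ln b) \<longlonglongrightarrow> 0 / ln b"
    using lb by (intro tendsto_divide tendsto_const) auto
  \<comment> \<open>This is the right side of the first inequality divided by \<open>m\<close>; it
    tends to 0 whatever the sign of \<open>d\<close>, so it is eventually below 1.\<close>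
  then have "(\<lambda>m. d * ((a + x - y) * (1 / real m) + ln (real m) / real m / ln b)) \<longlonglongrightarrow>
      d * ((a + x - y) * 0 + 0 / ln b)"
    by (intro tendsto_mult_left tendsto_add lim_1_over_n)
  then have "eventually (\<lambda>m::nat. d * ((a + x - y) * (1 / real m) + ln (real m) / real m / ln b) < 1) sequentially"
    by (rule order_tendstoD) simp
  with eventually_gt_at_top[of 0]
  have "eventually (\<lambda>m::nat. d * (a + ln (real m) / ln b + x - y) < real m) sequentially"
  proof eventually_elim
    case (elim m)
    have "real m * (1 / real m) = 1" "real m * (ln (real m) / real m / ln b) = ln (real m) / ln b"
      using elim(1) by auto
    moreover have "real m * (d * ((a + x - y) * (1 / real m) + ln (real m) / real m / ln b))
        = d * ((a + x - y) * (real m * (1 / real m)) + real m * (ln (real m) / real m / ln b))"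
      by (simp only: distrib_left mult_ac)
    ultimately have "d * (a + ln (real m) / ln b + x - y)
        = real m * (d * ((a + x - y) * (1 / real m) + ln (real m) / real m / ln b))"
      by (simp only: mult_1_right) (simp add: algebra_simps)
    also have "\<dots> < real m * 1"
      using elim by (intro mult_strict_left_mono) auto
    finally show ?case by simp
  qed
  moreover have "eventually (\<lambda>m::nat. c * exp (e * real m) > real m) sequentially" if "e > 0" for e
    using that assms(2) by real_asymp
  from this[of "ln b / k"] have "eventually (\<lambda>m::nat. c * exp (ln b / k * real m) > real m) sequentially"
    using lb assms(3) by simp
  ultimately show ?thesis
    by eventually_elim (use assms in \<open>auto simp: log_def powr_def mult_ac\<close>)
qed

text \<open>A single prime in \<open>A_primes r\<close> bounds \<open>m\<close> by some
  \<open>N\<close>. Then \<open>n\<close> is bounded through n <= (n + 1)! <= (r + 1) * D_r(n) = (r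
  + 1) * q * m! <= (r + 1) * q * N!, which explains the choice of \<open>M\<close>.\<close>

lemma finite_r_derangement_solutions:
  fixes r :: nat and q :: rat
  assumes "2 \<le> r" "A_primes r \<noteq> {}" "q \<noteq> 0"
  shows "finite {(n::nat, m::nat). n > 0 \<and> m > 0 \<and>
               of_nat (r_derangement_number r n) = q * fact m}" (is "finite ?S")
proof -
  obtain p where p: "p \<in> A_primes r" using assms(2) by blast
  then have "real p > 1" using prime_gt_1_nat by (auto simp: A_primes_def)
  let ?B = "\<lambda>m::nat. real m < (real p - 1) *
             (1 + log (real p) (real m)
                + real r * log (real p) (real r + exp 1 * real r * (2 + real_of_rat q))
                - real_of_int (padic_val p q))
        \<or> real m > real p powr (real_of_int (padic_val p q) / (real r + 1))
                    * real p powr (real m / ((real r + 1) * (real p - 1)))"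
  have "eventually (\<lambda>m. \<not> ?B m) sequentially"
    using \<open>real p > 1\<close> by (intro eventually_not_log_or_exp_bound) auto
  then obtain N where N: "\<And>m. m \<ge> N \<Longrightarrow> \<not> ?B m"
    unfolding eventually_sequentially by blast
  have m_less: "m < N" if "(n, m) \<in> ?S" for n m
  proof -
    have "m > 0" "of_nat (r_derangement_number r n) = q * fact m" using that by simp_all
    then have "?B m" by (rule r_derangement_solution_bounds[OF assms(1) p assms(3)])
    then show ?thesis using N[of m] not_le by blast
  qed
  define M where "M = nat \<lceil>of_nat (r + 1) * q * fact N\<rceil>"
  have n_le: "n \<le> M" if "(n, m) \<in> ?S" for n m
  proof -
    have sol: "of_nat (r_derangement_number r n) = q * fact m" using that by simp
    note pos = r_derangement_solution_pos[OF sol assms(3)]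
    have "n \<le> fact (n + 1)" using fact_ge_self[of "n + 1"] by linarith
    also have "\<dots> \<le> (r + 1) * r_derangement_number r n"
      using fact_le_r_derangement_number[OF assms(1) pos(3)] .
    finally have "of_nat n \<le> (of_nat ((r + 1) * r_derangement_number r n) :: rat)"
      by (rule of_nat_mono)
    also have "\<dots> = of_nat (r + 1) * q * fact m" unfolding of_nat_mult sol by simp
    also have "\<dots> \<le> of_nat (r + 1) * q * fact N"
      using m_less[OF that] pos(2) by (intro mult_left_mono fact_mono) auto
    finally show ?thesis unfolding M_def by linarith
  qed
  have "?S \<subseteq> {..M} \<times> {..N}"
  proof (rule subrelI)
    fix n m assume "(n, m) \<in> ?S"
    then show "(n, m) \<in> {..M} \<times> {..N}"
      using n_le[of n m] m_less[of n m] by (simp only: mem_Times_iff fst_conv snd_conv atMost_iff less_imp_le)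
  qed
  then show ?thesis
    by (rule finite_subset[OF _ finite_cartesian_product[OF finite_atMost finite_atMost]])
qed

theorem theorem17:
  fixes r :: nat
  assumes "r \<ge> 2"
    and "A_primes r \<noteq> {}"
  shows "\<forall>q::rat. q \<noteq> 0 \<longrightarrow>
     finite {(n::nat, m::nat). n > 0 \<and> m > 0 \<and>
               of_nat (r_derangement_number r n) = q * fact m} \<and>
     (\<forall>p\<in>A_primes r. \<forall>(n::nat) (m::nat).
        n > 0 \<and> m > 0 \<and> of_nat (r_derangement_number r n) = q * fact m \<longrightarrow>
          real m < (real p - 1) *
             (1 + log (real p) (real m)
                + real r * log (real p) (real r + exp 1 * real r * (2 + real_of_rat q))
                - real_of_int (padic_val p q))
        \<or> real m > real p powr (real_of_int (padic_val p q) / (real r + 1))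
                    * real p powr (real m / ((real r + 1) * (real p - 1))))"
proof (intro allI impI conjI ballI)
  fix q :: rat
  assume "q \<noteq> 0"
  then show "finite {(n::nat, m::nat). n > 0 \<and> m > 0 \<and>
               of_nat (r_derangement_number r n) = q * fact m}"
    using finite_r_derangement_solutions assms by blast
qed (elim conjE, rule r_derangement_solution_bounds[OF assms(1)]; assumption)

end
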